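(* Let $n\ge1$ and $k\ge0$ be integers, let $\alpha_1,\dots,\alpha_n,\phi_1,\dots,\phi_n\in\mathbb{C}$, let $\Delta\in\mathbb{C}$, and let $\tau=0$ or $\tau\in\mathbb{C}\setminus\{0,-1,-2,\dots\}$, such that $\tau+\Delta+\phi_i\notin\{0,-1,-2,\dots\}$ for all $i=1,\dots,n$. Let $f(z)=\sum_{i=1}^n\alpha_i\Gamma(z+\phi_i)$, and let $F_{\tau,j}=F_{\tau,j}(\Delta)$, $j=0,1,2,\dots$, be the numbers derived recursively from samples of $f$ as defined in the context. Then the $n\times n$ Hankel matrix ${}^{\tau,k}_{\ \ 1}\mathcal{H}_n:=\big(F_{\tau,k+r+s}\big)_{r,s=0}^{n-1}$ factorizes as $${}^{\tau,k}_{\ \ 1}\mathcal{H}_n=\mathcal{P}_nP_nZ_n\mathcal{P}_n^T,$$ where $\mathcal{P}_n=\big(\phi_i^{r}\big)_{r=0,\dots,n-1;\ i=1,\dots,n}$ (row index $r$, column index $i$), $Z_n=\mathrm{diag}\big(\alpha_1\Gamma(\tau+\Delta+\phi_1),\dots,\alpha_n\Gamma(\tau+\Delta+\phi_n)\big)$ and $P_n=\mathrm{diag}(\phi_1^k,\dots,\phi_n^k)$.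
   Context: $\Gamma$ is the gamma function; the convention $0^0=1$ is used. The quantities $F_{\tau,j}$ are defined recursively, as functions of $\Delta$, by $$F_{\tau,0}(\Delta):=f(\tau+\Delta),\qquad F_{\tau,j}(\Delta):=F_{\tau,j-1}(\Delta+1)-(\tau+\Delta)F_{\tau,j-1}(\Delta),\quad j=1,2,\dots$$ (all the evaluations of $f$ involved are at points $\tau+\Delta+j$ with $j\ge0$ an integer, where $f$ is well defined). *)

theory Defs
  imports "HOL-Analysis.Gamma_Function" "Jordan_Normal_Form.Matrix"
begin

(* Gamma is totalised by the value 0 at the poles 0, -1, -2, ... *)
definition gamma_sum :: "nat \<Rightarrow> (nat \<Rightarrow> complex) \<Rightarrow> (nat \<Rightarrow> complex) \<Rightarrow> complex \<Rightarrow> complex" where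
  "gamma_sum n \<alpha> \<phi> z = (\<Sum>i=1..n. \<alpha> i * Gamma (z + \<phi> i))"

primrec F :: "(complex \<Rightarrow> complex) \<Rightarrow> complex \<Rightarrow> nat \<Rightarrow> complex \<Rightarrow> complex" where
  "F f \<tau> 0 \<Delta> = f (\<tau> + \<Delta>)"
| "F f \<tau> (Suc j) \<Delta> = F f \<tau> j (\<Delta> + 1) - (\<tau> + \<Delta>) * F f \<tau> j \<Delta>"

definition hankel_mat :: "nat \<Rightarrow> nat \<Rightarrow> (nat \<Rightarrow> complex) \<Rightarrow> complex mat" where
  "hankel_mat n k a = Matrix.mat n n (\<lambda>(r, s). a (k + r + s))"

(* Matrix indices start at 0 while the parameters are numbered 1, ..., n: column (or diagonal
   position) i belongs to the parameter with number Suc i. *)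

definition vandermonde_mat :: "nat \<Rightarrow> (nat \<Rightarrow> complex) \<Rightarrow> complex mat" where
  "vandermonde_mat n \<phi> = Matrix.mat n n (\<lambda>(r, i). \<phi> (Suc i) ^ r)"

definition power_diag :: "nat \<Rightarrow> nat \<Rightarrow> (nat \<Rightarrow> complex) \<Rightarrow> complex mat" where
  "power_diag n k \<phi> = mat_diag n (\<lambda>i. \<phi> (Suc i) ^ k)"

definition gamma_diag :: "nat \<Rightarrow> (nat \<Rightarrow> complex) \<Rightarrow> (nat \<Rightarrow> complex) \<Rightarrow> complex \<Rightarrow> complex mat" where
  "gamma_diag n \<alpha> \<phi> z = mat_diag n (\<lambda>i. \<alpha> (Suc i) * Gamma (z + \<phi> (Suc i)))"

end

theory Submission
  imports Defs
begin

text \<open>By Gamma(z + 1) = z Gamma(z), one step of the recursion multiplies the i-th summand by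
  (\<tau> + \<Delta> + \<phi> i) - (\<tau> + \<Delta>) = \<phi> i. Hence the \<open>F\<close> values
  are power moments of the nodes \<phi> i with fixed weights (\<open>F_gamma_sum\<close>). In a
  moment of order k + r + s the power splits into factors for r, k and s, which is exactly an entry
  of the matrix product.\<close>

lemma F_gamma_sum:
  assumes "\<And>i. i \<in> {1..n} \<Longrightarrow> \<tau> + \<Delta> + \<phi> i \<notin> \<int>\<^sub>\<le>\<^sub>0"
  shows "F (gamma_sum n \<alpha> \<phi>) \<tau> j \<Delta> = (\<Sum>i=1..n. \<alpha> i * \<phi> i ^ j * Gamma (\<tau> + \<Delta> + \<phi> i))"
  using assms
\<comment> \<open>\<Delta> must vary, since the recursion also evaluates at \<Delta> + 1.\<close>
proof (induction j arbitrary: \<Delta>)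
  case 0
  then show ?case by (simp add: gamma_sum_def)
next
  case (Suc j)
  have shift: "\<tau> + (\<Delta> + 1) + \<phi> i = (\<tau> + \<Delta> + \<phi> i) + 1" for i
    by simp
  \<comment> \<open>Moving right by 1 cannot land on a pole: if z + 1 is a nonpositive integer, so
    is z.\<close>
  have "\<tau> + (\<Delta> + 1) + \<phi> i \<notin> \<int>\<^sub>\<le>\<^sub>0" if "i \<in> {1..n}" for i
    unfolding shift using Suc.prems[OF that] plus_one_in_nonpos_Ints_imp by blast
  then have "F (gamma_sum n \<alpha> \<phi>) \<tau> j (\<Delta> + 1)
      = (\<Sum>i=1..n. \<alpha> i * \<phi> i ^ j * Gamma (\<tau> + (\<Delta> + 1) + \<phi> i))"
    by (rule Suc.IH)
  \<comment> \<open>The functional equation needs the pole-free hypothesis: with the totalised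
    \<open>Gamma\<close> it fails at z = 0, where it would read 1 = 0.\<close>
  also have "\<dots> = (\<Sum>i=1..n. \<alpha> i * \<phi> i ^ j * ((\<tau> + \<Delta> + \<phi> i) * Gamma (\<tau> + \<Delta> + \<phi> i)))"
    unfolding shift using Suc.prems by (intro sum.cong refl) (simp add: Gamma_plus1)
  finally show ?case
    using Suc.IH[OF Suc.prems]
    by (simp add: sum_distrib_left flip: sum_subtractf) (simp add: algebra_simps)
qed

theorem theorem5:
  fixes n k :: nat and \<alpha> \<phi> :: "nat \<Rightarrow> complex" and \<Delta> \<tau> :: complex
  assumes "n \<ge> 1"
    and "\<tau> = 0 \<or> \<tau> \<notin> \<int>\<^sub>\<le>\<^sub>0"
    and "\<And>i. i \<in> {1..n} \<Longrightarrow> \<tau> + \<Delta> + \<phi> i \<notin> \<int>\<^sub>\<le>\<^sub>0"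
  shows "hankel_mat n k (\<lambda>j. F (gamma_sum n \<alpha> \<phi>) \<tau> j \<Delta>) =
    vandermonde_mat n \<phi> * power_diag n k \<phi> * gamma_diag n \<alpha> \<phi> (\<tau> + \<Delta>) *
      transpose_mat (vandermonde_mat n \<phi>)"
proof -
  let ?g = "\<lambda>i. \<alpha> i * Gamma (\<tau> + \<Delta> + \<phi> i)"
  \<comment> \<open>Diagonal factors on the right only scale columns, so the one genuine sum left is
    the product with the transpose.\<close>
  have VPZ: "vandermonde_mat n \<phi> * power_diag n k \<phi> * gamma_diag n \<alpha> \<phi> (\<tau> + \<Delta>)
      = Matrix.mat n n (\<lambda>(r, i). \<phi> (Suc i) ^ r * \<phi> (Suc i) ^ k * ?g (Suc i))"
    unfolding vandermonde_mat_def power_diag_def gamma_diag_def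
    by (intro eq_matI) (auto simp: mat_diag_mult_right[where nr = n])
  \<comment> \<open>The moments are reindexed from 0 to match the summation range of
    \<open>scalar_prod\<close>.\<close>
  have "F (gamma_sum n \<alpha> \<phi>) \<tau> j \<Delta> = (\<Sum>i=0..<n. \<phi> (Suc i) ^ j * ?g (Suc i))" for j
    by (subst F_gamma_sum[OF assms(3)])
      (simp_all add: sum.atLeast1_atMost_eq atLeast0LessThan mult_ac)
  then show ?thesis
    unfolding VPZ unfolding hankel_mat_def vandermonde_mat_def
    by (intro eq_matI) (auto simp: scalar_prod_def power_add mult_ac intro!: sum.cong)
qed

end
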